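(* For every pair of integers $t,k\in\mathbb{N}$ there exists $N\in\mathbb{N}$ such that every bipartite graph that excludes $P_t$, $\widetilde{P_t}$, and $H_k$ as induced subgraphs admits a $2$-cosplit of size at most $N$ and height at most $4k$.
   Context: Bipartite graphs come with a fixed bipartition into two sides; induced subgraphs inherit the bipartition, and "excludes $H$ as an induced subgraph" means no induced subgraph is isomorphic to $H$ as a bipartite graph. $P_t$ is the path on $t$ vertices, $\widetilde{P_t}$ its bipartite complement (adjacency between the two sides complemented). $H_k$ has sides $\{a_1,\dots,a_k\}$, $\{b_1,\dots,b_k\}$ and edges $a_ib_j$ for $1\le i\le j\le k$. For disjoint $A,B$, $G[A,B]$ is the bipartite graph with sides $A,B$ and the edges of $G$ between them. A cograph of height at most $h$ is a graph defined by a cotree: a rooted tree $T$ of height at most $h$ (max edges on a root-to-leaf path) whose leaves are the vertices, with $f:I(T)\to\{0,1\}$ on internal vertices, distinct leaves $u,v$ adjacent iff $f(u\wedge v)=1$ ($u\wedge v$ = lowest common ancestor). A bi-cograph of height at most $h$ is a bipartite graph defined by a bi-cotree: a rooted tree $T$ of height at most $h$ whose leaves are the vertices, $c$ the side-coloring of leaves into $\{1,2\}$, and $f:I(T)\times[2]\times[2]\to\{0,1\}$ symmetric in the last two arguments with $f(x,1,1)=f(x,2,2)=0$, where $u,v$ are adjacent iff $f(u\wedge v,c(u),c(v))=1$. For a bipartite graph $G$, a $2$-cosplit is a partition $\mathscr{P}$ of $V(G)$ such that every part is contained in one side of $G$, $G[A]$ is a cograph for every $A\in\mathscr{P}$, and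 $G[A,B]$ is a bi-cograph for all distinct $A,B\in\mathscr{P}$. Its size is $|\mathscr{P}|$; it has height at most $h$ if all these cographs and bi-cographs have height at most $h$. *)

theory Defs
  imports Main "HOL-Library.Disjoint_Sets"
begin

section \<open>Bipartite graphs\<close>

text \<open>A bipartite graph carries its bipartition. An edge is stored once, as a pair from the left
  to the right side; \<open>adj\<close> is the symmetric adjacency relation.\<close>

record 'a bigraph =
  lside :: "'a set"
  rside :: "'a set"
  bedges :: "('a \<times> 'a) set"

definition bipartite_graph :: "'a bigraph \<Rightarrow> bool" where
  "bipartite_graph G \<longleftrightarrow>
     finite (lside G) \<and> finite (rside G) \<and> lside G \<inter> rside G = {} \<and>
     bedges G \<subseteq> lside G \<times> rside G"

definition verts :: "'a bigraph \<Rightarrow> 'a set" where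
  "verts G = lside G \<union> rside G"

definition adj :: "'a bigraph \<Rightarrow> 'a \<Rightarrow> 'a \<Rightarrow> bool" where
  "adj G u v \<longleftrightarrow> (u, v) \<in> bedges G \<or> (v, u) \<in> bedges G"

definition induced :: "'a bigraph \<Rightarrow> 'a set \<Rightarrow> 'a bigraph" where
  "induced G W =
     \<lparr>lside = lside G \<inter> W, rside = rside G \<inter> W, bedges = bedges G \<inter> W \<times> W\<rparr>"

text \<open>The two sides are not ordered: an isomorphism maps the bipartition of \<open>G\<close> to that of \<open>H\<close>,
  possibly exchanging the sides. So a path on an odd number of vertices may start on either side.\<close>

definition bigraph_iso :: "'a bigraph \<Rightarrow> 'b bigraph \<Rightarrow> bool" where
  "bigraph_iso G H \<longleftrightarrow> (\<exists>f. bij_betw f (verts G) (verts H) \<and>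
     (f ` lside G = lside H \<and> f ` rside G = rside H \<or>
      f ` lside G = rside H \<and> f ` rside G = lside H) \<and>
     (\<forall>u\<in>verts G. \<forall>v\<in>verts G. adj G u v \<longleftrightarrow> adj H (f u) (f v)))"

definition excludes_induced :: "'a bigraph \<Rightarrow> 'b bigraph \<Rightarrow> bool" where
  "excludes_induced G H \<longleftrightarrow> \<not> (\<exists>W\<subseteq>verts G. bigraph_iso (induced G W) H)"

definition bicomplement :: "'a bigraph \<Rightarrow> 'a bigraph" where
  "bicomplement G =
     \<lparr>lside = lside G, rside = rside G, bedges = lside G \<times> rside G - bedges G\<rparr>"

definition path_graph :: "nat \<Rightarrow> nat bigraph" where
  "path_graph t =
     \<lparr>lside = {i. i < t \<and> even i}, rside = {i. i < t \<and> odd i},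
      bedges = {(i, j). i < t \<and> j < t \<and> even i \<and> odd j \<and> (j = i + 1 \<or> i = j + 1)}\<rparr>"

text \<open>The vertices \<open>a\<^sub>i\<close> and \<open>b\<^sub>j\<close> are \<open>Inl i\<close> and \<open>Inr j\<close>.\<close>

definition half_graph :: "nat \<Rightarrow> (nat + nat) bigraph" where
  "half_graph k =
     \<lparr>lside = Inl ` {1..k}, rside = Inr ` {1..k},
      bedges = {(Inl i, Inr j) | i j. 1 \<le> i \<and> i \<le> j \<and> j \<le> k}\<rparr>"

definition between :: "'a bigraph \<Rightarrow> 'a set \<Rightarrow> 'a set \<Rightarrow> 'a bigraph" where
  "between G A B =
     \<lparr>lside = A, rside = B, bedges = {(u, v). u \<in> A \<and> v \<in> B \<and> adj G u v}\<rparr>"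

section \<open>Cotrees and bi-cotrees\<close>

text \<open>Rooted trees whose leaves are graph vertices; the label of an internal node \<open>x\<close> is the value
  of \<open>f\<close> at \<open>x\<close>.\<close>

datatype (labels: 'l, leaf_set: 'a) rtree = Leaf 'a | Node 'l "('l, 'a) rtree list"

fun leaves :: "('l, 'a) rtree \<Rightarrow> 'a list" where
  "leaves (Leaf x) = [x]"
| "leaves (Node l ts) = concat (map leaves ts)"

fun internal_nonempty :: "('l, 'a) rtree \<Rightarrow> bool" where
  "internal_nonempty (Leaf x) \<longleftrightarrow> True"
| "internal_nonempty (Node l ts) \<longleftrightarrow> ts \<noteq> [] \<and> (\<forall>s\<in>set ts. internal_nonempty s)"

text \<open>The leaves of \<open>T\<close> are exactly the elements of \<open>V\<close>, each occurring once.\<close>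

definition tree_on :: "'a set \<Rightarrow> ('l, 'a) rtree \<Rightarrow> bool" where
  "tree_on V T \<longleftrightarrow> internal_nonempty T \<and> distinct (leaves T) \<and> set (leaves T) = V"

fun height :: "('l, 'a) rtree \<Rightarrow> nat" where
  "height (Leaf x) = 0"
| "height (Node l ts) = Suc (Max (height ` set ts))"

text \<open>The lowest common ancestor of two leaves, given as the subtree rooted at it.\<close>

function lca :: "('l, 'a) rtree \<Rightarrow> 'a \<Rightarrow> 'a \<Rightarrow> ('l, 'a) rtree" where
  "lca (Leaf x) u v = Leaf x"
| "lca (Node l ts) u v =
     (case find (\<lambda>s. u \<in> set (leaves s) \<and> v \<in> set (leaves s)) ts of
        None \<Rightarrow> Node l ts
      | Some s \<Rightarrow> lca s u v)"
  by pat_completeness auto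
termination
  by (relation "measure (\<lambda>(t, u, v). size t)")
    (auto simp: find_Some_iff less_Suc_eq_le intro!: size_list_estimation' nth_mem)

text \<open>The label of the root; the value at a leaf is irrelevant.\<close>

fun root_label :: "('l, 'a) rtree \<Rightarrow> 'l" where
  "root_label (Node l ts) = l"
| "root_label (Leaf x) = undefined"

definition cograph_height_le :: "nat \<Rightarrow> 'a set \<Rightarrow> ('a \<Rightarrow> 'a \<Rightarrow> bool) \<Rightarrow> bool" where
  "cograph_height_le h V E \<longleftrightarrow> (\<exists>T :: (bool, 'a) rtree.
     tree_on V T \<and> height T \<le> h \<and>
     (\<forall>u\<in>V. \<forall>v\<in>V. u \<noteq> v \<longrightarrow> (E u v \<longleftrightarrow> root_label (lca T u v))))"

definition cograph :: "'a set \<Rightarrow> ('a \<Rightarrow> 'a \<Rightarrow> bool) \<Rightarrow> bool" where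
  "cograph V E \<longleftrightarrow> (\<exists>h. cograph_height_le h V E)"

datatype side = Side1 | Side2

definition side_of :: "'a bigraph \<Rightarrow> 'a \<Rightarrow> side" where
  "side_of G u = (if u \<in> lside G then Side1 else Side2)"

definition bicotree_label :: "(side \<Rightarrow> side \<Rightarrow> bool) \<Rightarrow> bool" where
  "bicotree_label f \<longleftrightarrow>
     (\<forall>i j. f i j = f j i) \<and> \<not> f Side1 Side1 \<and> \<not> f Side2 Side2"

definition bicograph_height_le :: "nat \<Rightarrow> 'a bigraph \<Rightarrow> bool" where
  "bicograph_height_le h G \<longleftrightarrow> (\<exists>T :: (side \<Rightarrow> side \<Rightarrow> bool, 'a) rtree.
     tree_on (verts G) T \<and> height T \<le> h \<and> (\<forall>f\<in>labels T. bicotree_label f) \<and>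
     (\<forall>u\<in>verts G. \<forall>v\<in>verts G. u \<noteq> v \<longrightarrow>
        (adj G u v \<longleftrightarrow> root_label (lca T u v) (side_of G u) (side_of G v))))"

definition bicograph :: "'a bigraph \<Rightarrow> bool" where
  "bicograph G \<longleftrightarrow> (\<exists>h. bicograph_height_le h G)"

section \<open>2-cosplits\<close>

text \<open>The induced subgraph on a part \<open>A\<close> is passed to \<open>cograph\<close> as the vertex set \<open>A\<close> with the
  adjacency of \<open>G\<close>, which \<open>cograph\<close> only inspects on \<open>A\<close>.\<close>

definition two_cosplit :: "'a bigraph \<Rightarrow> 'a set set \<Rightarrow> bool" where
  "two_cosplit G P \<longleftrightarrow>
     partition_on (verts G) P \<and>
     (\<forall>A\<in>P. A \<subseteq> lside G \<or> A \<subseteq> rside G) \<and>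
     (\<forall>A\<in>P. cograph A (adj G)) \<and>
     (\<forall>A\<in>P. \<forall>B\<in>P. A \<noteq> B \<longrightarrow> bicograph (between G A B))"

definition cosplit_height_le :: "nat \<Rightarrow> 'a bigraph \<Rightarrow> 'a set set \<Rightarrow> bool" where
  "cosplit_height_le h G P \<longleftrightarrow>
     (\<forall>A\<in>P. cograph_height_le h A (adj G)) \<and>
     (\<forall>A\<in>P. \<forall>B\<in>P. A \<noteq> B \<longrightarrow> bicograph_height_le h (between G A B))"

end

theory Submission
  imports Defs
begin

text \<open>Call a colouring good if every left class together with every right class induces a
  bi-cograph of the required height. If no good colouring with few colours remains after
  discarding the neighbours of a left vertex, that vertex is of type \<open>L-\<close>, and if none remains after
  discarding its right non-neighbours, it is of type \<open>L+\<close>; likewise \<open>R-\<close>, \<open>R+\<close>.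
  Alternating steps of types \<open>L+\<close> and \<open>R-\<close> build a half graph, and so do
  alternating steps of types \<open>R+\<close> and \<open>L-\<close>, so after \<open>2 * k\<close> steps of either kind \<open>H\<^sub>k\<close> appears.
  At any moment each of the two sequences asks for one type. If neither type is available, then
  either they are \<open>L+\<close> and \<open>L-\<close> (or \<open>R+\<close> and \<open>R-\<close>), and splitting the graph at a single vertex gives a
  good colouring, or both have the same sign, and Gyarfas' path argument gives a long induced path
  in the graph or in its bipartite complement, unless a good colouring exists. For a fixed pair of
  classes all the disjoint unions taken in the path argument merge into one, so each of the at most
  \<open>4 * k\<close> steps adds only one level to the bi-cotrees.\<close>

section \<open>Connected sets of a symmetric relation\<close>

definition edges_on :: "('a \<Rightarrow> 'a \<Rightarrow> bool) \<Rightarrow> 'a set \<Rightarrow> ('a \<times> 'a) set" where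
  "edges_on e D = {(x, y). x \<in> D \<and> y \<in> D \<and> e x y}"

text \<open>The empty set counts as connected, so a quantifier over connected sets includes
  it.\<close>

definition conn :: "('a \<Rightarrow> 'a \<Rightarrow> bool) \<Rightarrow> 'a set \<Rightarrow> bool" where
  "conn e D \<longleftrightarrow> (\<forall>x\<in>D. \<forall>y\<in>D. (x, y) \<in> (edges_on e D)\<^sup>*)"

definition component :: "('a \<Rightarrow> 'a \<Rightarrow> bool) \<Rightarrow> 'a set \<Rightarrow> 'a \<Rightarrow> 'a set" where
  "component e W x = {y \<in> W. (x, y) \<in> (edges_on e W)\<^sup>*}"

lemma component_subset: "component e W x \<subseteq> W"
  by (auto simp: component_def)

lemma component_refl: "x \<in> W \<Longrightarrow> x \<in> component e W x"
  by (auto simp: component_def)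

lemma component_closed: "y \<in> component e W x \<Longrightarrow> z \<in> W \<Longrightarrow> e y z \<Longrightarrow> z \<in> component e W x"
  by (auto simp: component_def edges_on_def intro: rtrancl_into_rtrancl)

lemma edges_on_mono: "D \<subseteq> W \<Longrightarrow> edges_on e D \<subseteq> edges_on e W"
  by (auto simp: edges_on_def)

lemma conn_subset_component: "conn e D \<Longrightarrow> D \<subseteq> W \<Longrightarrow> x \<in> D \<Longrightarrow> D \<subseteq> component e W x"
  unfolding conn_def component_def using rtrancl_mono[OF edges_on_mono[of D W e]] by blast

lemma sym_edges_on_rtrancl: "symp e \<Longrightarrow> sym ((edges_on e D)\<^sup>*)"
  by (rule sym_rtrancl) (auto simp: sym_def edges_on_def symp_def)

lemma component_eq:
  assumes "symp e" "y \<in> component e W x" shows "component e W y = component e W x"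
proof -
  have xy: "(x, y) \<in> (edges_on e W)\<^sup>*" using assms(2) by (simp add: component_def)
  then have "(y, x) \<in> (edges_on e W)\<^sup>*" using symD[OF sym_edges_on_rtrancl[OF assms(1)]] by blast
  then show ?thesis using xy rtrancl_trans unfolding component_def by fast
qed

text \<open>A walk in \<open>W\<close> from \<open>x\<close> never leaves the component, so it is
  already a walk there; symmetry joins two such walks at \<open>x\<close>.\<close>

lemma conn_component:
  assumes "symp e" "x \<in> W" shows "conn e (component e W x)"
proof -
  have reach: "(x, y) \<in> (edges_on e (component e W x))\<^sup>*" if "(x, y) \<in> (edges_on e W)\<^sup>*" for y
    using that
  proof induction
    case (step y z)
    then have "y \<in> component e W x" "z \<in> component e W x" "e y z"
      by (auto simp: component_def edges_on_def intro: rtrancl_into_rtrancl)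
    then show ?case using step.IH by (auto simp: edges_on_def intro: rtrancl_into_rtrancl)
  qed simp
  show ?thesis unfolding conn_def
    using reach sym_edges_on_rtrancl[OF assms(1)]
    by (smt (verit, best) component_def mem_Collect_eq rtrancl_trans symE)
qed

text \<open>A walk in \<open>D\<close> from \<open>x\<close> to \<open>z\<close> starts in
  \<open>C\<close> and ends outside, so one of its edges leaves \<open>C\<close>.\<close>

lemma conn_exit:
  assumes "conn e D" "C \<subseteq> D" "x \<in> C" "z \<in> D" "z \<notin> C"
  obtains y w where "y \<in> C" "w \<in> D" "w \<notin> C" "e y w"
proof -
  have "(x, z) \<in> (edges_on e D)\<^sup>*" using assms by (auto simp: conn_def)
  then have "z \<notin> C \<longrightarrow> (\<exists>y\<in>C. \<exists>w\<in>D - C. e y w)"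
    by induction (use assms in \<open>auto simp: edges_on_def\<close>)
  then show ?thesis using assms that by blast
qed

section \<open>Colourings whose pairs of classes lie in a hereditary class\<close>

text \<open>The graph is a relation on the whole type, with \<open>s\<close> true on the left.
  Induced subgraph, bipartite complement and exchange of sides then change only the vertex set,
  \<open>e\<close> and \<open>s\<close> respectively.\<close>

definition bipartite_rel :: "('a \<Rightarrow> bool) \<Rightarrow> ('a \<Rightarrow> 'a \<Rightarrow> bool) \<Rightarrow> bool" where
  "bipartite_rel s e \<longleftrightarrow> (\<forall>u v. e u v \<longrightarrow> e v u \<and> s u \<noteq> s v)"

definition cross_compl :: "('a \<Rightarrow> bool) \<Rightarrow> ('a \<Rightarrow> 'a \<Rightarrow> bool) \<Rightarrow> 'a \<Rightarrow> 'a \<Rightarrow> bool" where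
  "cross_compl s e u v \<longleftrightarrow> s u \<noteq> s v \<and> \<not> e u v"

text \<open>Vertices on the side of \<open>v\<close> are kept, so for the complement relation this leaves that whole
  side together with the neighbours of \<open>v\<close>.\<close>

definition non_nbrs :: "('a \<Rightarrow> 'a \<Rightarrow> bool) \<Rightarrow> 'a \<Rightarrow> 'a set \<Rightarrow> 'a set" where
  "non_nbrs e v W = {u \<in> W. \<not> e v u}"

abbreviation nbrs :: "('a \<Rightarrow> bool) \<Rightarrow> ('a \<Rightarrow> 'a \<Rightarrow> bool) \<Rightarrow> 'a \<Rightarrow> 'a set \<Rightarrow> 'a set" where
  "nbrs s e \<equiv> non_nbrs (cross_compl s e)"

lemma bipartite_rel_cross_compl: "bipartite_rel s e \<Longrightarrow> bipartite_rel s (cross_compl s e)"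
  by (auto simp: bipartite_rel_def cross_compl_def)

lemma cross_compl_twice: "bipartite_rel s e \<Longrightarrow> cross_compl s (cross_compl s e) = e"
  by (intro ext) (auto simp: bipartite_rel_def cross_compl_def)

lemma cross_compl_Not: "cross_compl (Not \<circ> s) e = cross_compl s e"
  by (intro ext) (auto simp: cross_compl_def)

lemma bipartite_rel_symp: "bipartite_rel s e \<Longrightarrow> symp e"
  by (auto simp: bipartite_rel_def symp_def)

lemma non_nbrs_subset: "non_nbrs e v W \<subseteq> W"
  by (auto simp: non_nbrs_def)

lemma non_nbrs_mono: "D \<subseteq> W \<Longrightarrow> non_nbrs e v D \<subseteq> non_nbrs e v W"
  by (auto simp: non_nbrs_def)

section \<open>Hereditary classes and good colourings\<close>

definition hereditary :: "('a set \<Rightarrow> bool) \<Rightarrow> bool" where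
  "hereditary P \<longleftrightarrow> (\<forall>X Y. Y \<subseteq> X \<longrightarrow> P X \<longrightarrow> P Y)"

lemma hereditaryD: "hereditary P \<Longrightarrow> P X \<Longrightarrow> Y \<subseteq> X \<Longrightarrow> P Y"
  by (auto simp: hereditary_def)

text \<open>The two sides have independent palettes, both read off \<open>c\<close>: the set in the
  last conjunct is the left class \<open>i\<close> together with the right class \<open>j\<close>.
  Indices from \<open>n\<close> on give empty classes, so single classes are covered too.\<close>

definition good :: "('a \<Rightarrow> bool) \<Rightarrow> nat \<Rightarrow> ('a set \<Rightarrow> bool) \<Rightarrow> 'a set \<Rightarrow> bool" where
  "good s n P W \<longleftrightarrow> (\<exists>c. (\<forall>x\<in>W. c x < n) \<and> (\<forall>i j. P {x \<in> W. c x = (if s x then i else j)}))"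

lemma goodI:
  assumes "\<And>x. x \<in> W \<Longrightarrow> c x < n" "\<And>i j. P {x \<in> W. c x = (if s x then i else j)}"
  shows "good s n P W"
  unfolding good_def using assms by (intro exI[of _ c] conjI ballI allI)

lemma goodE:
  assumes "good s n P W"
  obtains c where "\<And>x. x \<in> W \<Longrightarrow> c x < n"
    "\<And>i j. P {x \<in> W. c x = (if s x then i else j)}"
proof -
  from assms obtain c where "(\<forall>x\<in>W. c x < n) \<and> (\<forall>i j. P {x \<in> W. c x = (if s x then i else j)})"
    unfolding good_def ..
  then show ?thesis using that[of c] by blast
qed

lemma good_subset:
  assumes her: "hereditary P" and "good s n P W" and "D \<subseteq> W" shows "good s n P D"
proof -
  obtain c where c: "\<And>x. x \<in> W \<Longrightarrow> c x < n" "\<And>i j. P {x \<in> W. c x = (if s x then i else j)}"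
    using goodE[OF assms(2)] by blast
  show ?thesis
  proof (rule goodI)
    show "P {x \<in> D. c x = (if s x then i else j)}" for i j
      using assms(3) by (intro hereditaryD[OF her c(2)[of i j]]) auto
  qed (use c(1) assms(3) in blast)
qed

lemma good_mono: "good s n P W \<Longrightarrow> n \<le> m \<Longrightarrow> (\<And>X. P X \<Longrightarrow> Q X) \<Longrightarrow> good s m Q W"
  unfolding good_def by (meson order_less_le_trans)

lemma good_trivial: "P W \<Longrightarrow> hereditary P \<Longrightarrow> n > 0 \<Longrightarrow> good s n P W"
  unfolding good_def by (rule exI[of _ "\<lambda>_. 0"]) (auto elim: hereditaryD)

lemma good_singleton:
  assumes "good s n P {v}" shows "P {v}"
proof (rule goodE[OF assms])
  fix c :: "'a \<Rightarrow> nat" assume *: "\<And>i j. P {x \<in> {v}. c x = (if s x then i else j)}"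
  have "{x \<in> {v}. c x = (if s x then c v else c v)} = {v}" by (rule set_eqI) auto
  then show "P {v}" using *[of "c v" "c v"] by (rule subst)
qed

lemma good_empty:
  assumes "good s n P {}" shows "P {}"
proof (rule goodE[OF assms])
  fix c :: "'a \<Rightarrow> nat" assume *: "\<And>i j. P {x \<in> {}. c x = (if s x then i else j)}"
  have "{x \<in> {}. c x = (if s x then 0 else 0)} = {}" by simp
  then show "P {}" using *[of 0 0] by (rule subst)
qed

text \<open>The side of \<open>v\<close> lies in both pieces and receives the pair of its two
  colours, coded as \<open>c x * m + d x\<close>; on the other side neighbours keep \<open>c\<close>
  and non-neighbours use the fresh colours \<open>n + d x\<close>. The bound covers both
  palettes.\<close>

lemma good_split:
  assumes bip: "bipartite_rel s e" and her: "hereditary P"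
    and 1: "good s n P (nbrs s e v W)" and 2: "good s m P (non_nbrs e v W)"
  shows "good s (n * m + n + m) P W"
proof -
  let ?N = "nbrs s e v W" and ?M = "non_nbrs e v W"
  obtain c where c: "\<And>x. x \<in> ?N \<Longrightarrow> c x < n"
    and Pc: "\<And>i j. P {x \<in> ?N. c x = (if s x then i else j)}"
    using goodE[OF 1] by blast
  obtain d where d: "\<And>x. x \<in> ?M \<Longrightarrow> d x < m"
    and Pd: "\<And>i j. P {x \<in> ?M. d x = (if s x then i else j)}"
    using goodE[OF 2] by blast
  have own: "x \<in> ?N \<and> x \<in> ?M" if "x \<in> W" "s x = s v" for x
    using that bip by (auto simp: non_nbrs_def cross_compl_def bipartite_rel_def)
  have opp: "x \<in> (if e v x then ?N else ?M)" if "x \<in> W" for x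
    using that by (auto simp: non_nbrs_def cross_compl_def)
  define g where "g x = (if s x = s v then c x * m + d x else if e v x then c x else n + d x)" for x
  show ?thesis unfolding good_def
  proof (rule exI[of _ g], intro conjI ballI allI)
    fix x assume x: "x \<in> W"
    show "g x < n * m + n + m"
    proof (cases "s x = s v")
      case True
      then have "c x < n" "d x < m" using c d own[OF x] by auto
      then have "c x * m + d x < Suc (c x) * m" "Suc (c x) * m \<le> n * m"
        by (simp, intro mult_le_mono1) simp
      then show ?thesis using True by (auto simp: g_def)
    next
      case False
      then show ?thesis using c[of x] d[of x] opp[OF x] by (auto simp: g_def split: if_splits)
    qed
  next
    fix i j :: nat
    \<comment> \<open>\<open>k\<close> is the requested colour on the side of \<open>v\<close>, and
      \<open>l\<close> the one on the opposite side.\<close>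
    define k where "k = (if s v then i else j)"
    define l where "l = (if s v then j else i)"
    let ?X = "{x \<in> W. g x = (if s x then i else j)}"
    have k: "c x = k div m \<and> d x = k mod m" if "x \<in> ?X" "s x = s v" for x
    proof -
      have "d x < m" using d own that by blast
      moreover have "k = c x * m + d x" using that by (auto simp: g_def k_def split: if_splits)
      ultimately show ?thesis by simp
    qed
    have l: "l = (if e v x then c x else n + d x)" if "x \<in> ?X" "s x \<noteq> s v" for x
      using that by (auto simp: g_def l_def split: if_splits)
    show "P ?X"
    \<comment> \<open>The opposite colour alone decides whether that class consists of neighbours or
      of non-neighbours of \<open>v\<close>. So the pair of classes lies inside one piece, where
      \<open>k\<close> decodes to a single colour.\<close>
    proof (cases "l < n")
      case True
      define p q where "p = (if s v then k div m else l)" and "q = (if s v then l else k div m)"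
      have "x \<in> ?N \<and> c x = (if s x then p else q)" if x: "x \<in> ?X" for x
      proof (cases "s x = s v")
        case True
        then show ?thesis using k[OF x] own x by (auto simp: p_def q_def)
      next
        case False
        then show ?thesis using l[OF x False] opp[of x] x \<open>l < n\<close>
          by (auto simp: p_def q_def split: if_splits)
      qed
      then show ?thesis by (intro hereditaryD[OF her Pc[of p q]]) blast
    next
      case False
      define p q where "p = (if s v then k mod m else l - n)" and "q = (if s v then l - n else k mod m)"
      have "x \<in> ?M \<and> d x = (if s x then p else q)" if x: "x \<in> ?X" for x
      proof (cases "s x = s v")
        case True
        then show ?thesis using k[OF x] own x by (auto simp: p_def q_def)
      next
        case F: False
        have "\<not> e v x" using l[OF x F] False opp[of x] x c[of x] by auto
        then show ?thesis using l[OF x F] F opp[of x] x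
          by (auto simp: p_def q_def split: if_splits)
      qed
      then show ?thesis by (intro hereditaryD[OF her Pd[of p q]]) blast
    qed
  qed
qed

section \<open>Components and the path argument\<close>

text \<open>For hereditary \<open>P\<close> and symmetric \<open>e\<close> this says that
  \<open>P\<close> holds for every component of \<open>W\<close> and for the empty set. Quantifying
  over connected sets makes it hereditary by itself.\<close>

definition conn_all :: "('a \<Rightarrow> 'a \<Rightarrow> bool) \<Rightarrow> ('a set \<Rightarrow> bool) \<Rightarrow> 'a set \<Rightarrow> bool" where
  "conn_all e P W \<longleftrightarrow> (\<forall>D\<subseteq>W. conn e D \<longrightarrow> P D)"

lemma hereditary_conn_all: "hereditary (conn_all e P)"
  by (auto simp: hereditary_def conn_all_def)

lemma conn_allI: "hereditary P \<Longrightarrow> P W \<Longrightarrow> conn_all e P W"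
  by (auto simp: conn_all_def elim: hereditaryD)

text \<open>Each vertex is coloured by the colouring chosen for its component. A connected set
  inside a pair of classes stays within one component, so all components share the same
  \<open>n\<close> colours. As they are only assumed good for \<open>conn_all e P\<close>, disjoint
  unions do not nest: iterating the lemma adds no height.\<close>

lemma good_conn_all:
  assumes sym: "symp e" and empty: "P {}"
    and comps: "\<And>x. x \<in> W \<Longrightarrow> good s n (conn_all e P) (component e W x)"
  shows "good s n (conn_all e P) W"
proof -
  have "\<forall>x\<in>component e W ` W. \<exists>c. (\<forall>y\<in>x. c y < n) \<and>
      (\<forall>i j. conn_all e P {y \<in> x. c y = (if s y then i else j)})"
    using comps unfolding good_def by (rule_tac ballI) (elim imageE, simp only:)
  from bchoice[OF this] obtain c where c: "\<forall>D\<in>component e W ` W. (\<forall>y\<in>D. c D y < n) \<and>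
      (\<forall>i j. conn_all e P {y \<in> D. c D y = (if s y then i else j)})" ..
  have bound: "c (component e W x) y < n" if "x \<in> W" "y \<in> component e W x" for x y
    using c that by blast
  have cls: "conn_all e P {y \<in> component e W x. c (component e W x) y = (if s y then i else j)}"
    if "x \<in> W" for x i j
    using c that by blast
  show ?thesis unfolding good_def
  proof (rule exI[of _ "\<lambda>x. c (component e W x) x"], intro conjI ballI allI)
    fix i j :: nat
    let ?X = "{x \<in> W. c (component e W x) x = (if s x then i else j)}"
    show "conn_all e P ?X" unfolding conn_all_def
    proof (intro allI impI)
      fix D assume D: "D \<subseteq> ?X" "conn e D"
      show "P D"
      proof (cases "D = {}")
        case False
        then obtain x where x: "x \<in> D" by blast
        let ?C = "component e W x"
        have xW: "x \<in> W" and DW: "D \<subseteq> W" using D(1) x by auto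
        have DC: "D \<subseteq> ?C" using conn_subset_component[OF D(2) DW x] .
        have "y \<in> ?C \<and> c ?C y = (if s y then i else j)" if "y \<in> D" for y
        proof -
          have "y \<in> ?C" using that DC by blast
          moreover have "c (component e W y) y = (if s y then i else j)" using D(1) that by blast
          ultimately show ?thesis using component_eq[OF sym] by metis
        qed
        then have "D \<subseteq> {y \<in> ?C. c ?C y = (if s y then i else j)}" by blast
        then show ?thesis using cls[OF xW, of i j] D(2) unfolding conn_all_def by blast
      qed (simp add: empty)
    qed
  qed (auto intro: bound component_refl)
qed

section \<open>Induced paths and the path argument\<close>

definition ipath :: "('a \<Rightarrow> 'a \<Rightarrow> bool) \<Rightarrow> 'a list \<Rightarrow> bool" where
  "ipath e xs \<longleftrightarrow> distinct xs \<and>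
     (\<forall>i<length xs. \<forall>j<length xs. e (xs ! i) (xs ! j) \<longleftrightarrow> i = Suc j \<or> j = Suc i)"

lemma ipath_Cons:
  assumes "bipartite_rel s e" "ipath e (w # xs)" "e v w" "v \<notin> set xs" "\<forall>x\<in>set xs. \<not> e v x"
  shows "ipath e (v # w # xs)"
proof -
  have sym: "e x y \<Longrightarrow> e y x" and irr: "\<not> e x x" for x y
    using assms(1) by (auto simp: bipartite_rel_def)
  have vn: "e v ((w # xs) ! j) \<longleftrightarrow> j = 0" if "j < length (w # xs)" for j
    using assms(3,5) that by (cases j) auto
  have vn': "e ((w # xs) ! j) v \<longleftrightarrow> j = 0" if "j < length (w # xs)" for j
    using vn[OF that] sym by blast
  have "v \<noteq> w" using assms(3) irr by auto
  have "e ((v # w # xs) ! i) ((v # w # xs) ! j) \<longleftrightarrow> i = Suc j \<or> j = Suc i"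
    if "i < length (v # w # xs)" "j < length (v # w # xs)" for i j
  proof (cases i)
    case 0
    then show ?thesis using that vn irr by (cases j) auto
  next
    case (Suc i')
    then show ?thesis
    proof (cases j)
      case 0
      then show ?thesis using that vn' Suc by auto
    next
      case (Suc j')
      then show ?thesis using that assms(2) \<open>i = Suc i'\<close> by (auto simp: ipath_def)
    qed
  qed
  moreover have "distinct (v # w # xs)"
    using assms(2,4) \<open>v \<noteq> w\<close> by (auto simp: ipath_def)
  ultimately show ?thesis unfolding ipath_def by blast
qed

text \<open>The colour count of \<open>good_split\<close> when every path vertex costs one split:
  \<open>n\<close> colours for its neighbourhood and the previous bound for the rest.\<close>

fun path_bound :: "nat \<Rightarrow> nat \<Rightarrow> nat" where
  "path_bound n 0 = n"
| "path_bound n (Suc r) = n * path_bound n r + n + path_bound n r"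

lemma path_bound_ge: "n \<le> path_bound n r"
  by (induction r) auto

text \<open>Gyarfas' path argument: \<open>v\<close> is the current end of the path, which is continued into a
  component of the non-neighbours of \<open>v\<close> in \<open>D\<close>.\<close>

lemma path_or_good:
  assumes bip: "bipartite_rel s e" and her: "hereditary P"
    and "conn e D" and "z \<in> D" "z = v \<or> e v z"
    and "\<And>u. u \<in> insert v D \<Longrightarrow> good s n P (nbrs s e u D)"
  shows "(\<exists>xs. length xs = r \<and> set xs \<subseteq> D \<and> ipath e (v # xs)) \<or>
    good s (path_bound n r) (conn_all e P) D"
  using assms(3-)
proof (induction r arbitrary: v D z)
  case 0
  have "\<not> e v v" using bip by (auto simp: bipartite_rel_def)
  then have "ipath e [v]" by (auto simp: ipath_def)
  then show ?case by auto
next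
  case (Suc r)
  note sym = bipartite_rel_symp[OF bip]
  let ?W = "non_nbrs e v D"
  have small: "good s n P (nbrs s e v D)" using Suc.prems(4) by blast
  have "P {}" using good_empty[OF good_subset[OF her small empty_subsetI]] .
  show ?case
  proof (rule disjCI)
    assume not_good: "\<not> good s (path_bound n (Suc r)) (conn_all e P) D"
    \<comment> \<open>Splitting at \<open>v\<close> would combine such a colouring with the one of
      the neighbourhood, using exactly \<open>path_bound n (Suc r)\<close> colours.\<close>
    have "\<not> good s (path_bound n r) (conn_all e P) ?W"
    proof
      assume "good s (path_bound n r) (conn_all e P) ?W"
      moreover have "good s n (conn_all e P) (nbrs s e v D)"
        using small conn_allI[OF her] by (rule good_mono[OF _ order_refl])
      ultimately show False
        using not_good good_split[OF bip hereditary_conn_all] by fastforce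
    qed
    then obtain x where x: "x \<in> ?W" and bad: "\<not> good s (path_bound n r) (conn_all e P) (component e ?W x)"
      using good_conn_all[where P = P and W = ?W, OF sym \<open>P {}\<close>] by blast
    let ?C = "component e ?W x"
    have C: "?C \<subseteq> ?W" "?W \<subseteq> D" by (rule component_subset, rule non_nbrs_subset)
    \<comment> \<open>\<open>v\<close> may belong to \<open>D\<close>, but it is isolated in
      \<open>?W\<close>, so its component would be \<open>{v}\<close>. One colour suffices there,
      and \<open>n > 0\<close> because the colouring in \<open>small\<close> assigns a colour to
      \<open>v\<close>.\<close>
    have vC: "v \<notin> ?C"
    proof
      assume v: "v \<in> ?C"
      have "?C = {v}"
      proof (rule ccontr)
        assume "?C \<noteq> {v}"
        then obtain z where "z \<in> ?C" "z \<notin> {v}" using v by blast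
        then obtain w where "w \<in> ?C" "e v w"
          using conn_exit[OF conn_component[OF sym x], of "{v}" v z] v by auto
        then show False using C by (auto simp: non_nbrs_def)
      qed
      moreover have v': "v \<in> nbrs s e v D"
        using v C by (auto simp: non_nbrs_def cross_compl_def)
      then have "P {v}" using good_singleton[OF good_subset[OF her small]] by blast
      moreover obtain c where "c v < n" using goodE[OF small] v' by metis
      ultimately have "good s n P ?C" using good_trivial[OF _ her] by simp
      then have "good s (path_bound n r) (conn_all e P) ?C"
        by (rule good_mono[OF _ path_bound_ge]) (rule conn_allI[OF her])
      then show False using bad by contradiction
    qed
    have "z \<notin> ?C" using vC Suc.prems(3) C by (auto simp: non_nbrs_def)
    \<comment> \<open>Connectedness of \<open>D\<close> gives an edge from \<open>?C\<close> towards
      \<open>z\<close>. Its end \<open>w\<close> is outside the component, hence was removed as a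
      neighbour of \<open>v\<close>: it is the next path vertex.\<close>
    then obtain y w where w: "y \<in> ?C" "w \<in> D" "w \<notin> ?C" "e y w"
      using conn_exit[OF Suc.prems(1), of ?C x z] Suc.prems(2) C component_refl[OF x] by blast
    then have vw: "e v w" using component_closed[of y e ?W x w] by (auto simp: non_nbrs_def)
    \<comment> \<open>The new path end \<open>w\<close> lies outside \<open>?C\<close>, which is why
      the smallness hypothesis ranges over \<open>insert v D\<close>.\<close>
    have "good s n P (nbrs s e u ?C)" if "u \<in> insert w ?C" for u
    proof -
      have "u \<in> insert v D" using that w C by blast
      then show ?thesis
        using good_subset[OF her Suc.prems(4) non_nbrs_mono] C by blast
    qed
    then obtain xs where xs: "length xs = r" "set xs \<subseteq> ?C" "ipath e (w # xs)"
      using Suc.IH[OF conn_component[OF sym x], of y w] w bad sympD[OF sym] by blast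
    have "ipath e (v # w # xs)"
      using xs vC C by (intro ipath_Cons[OF bip xs(3) vw]) (auto simp: non_nbrs_def)
    then show "\<exists>xs. length xs = Suc r \<and> set xs \<subseteq> D \<and> ipath e (v # xs)"
      using xs w C by (intro exI[of _ "w # xs"]) auto
  qed
qed

text \<open>The path argument is started in each component at one of its own vertices
  \<open>x\<close>. A long outcome has \<open>t\<close> vertices after \<open>x\<close>, and
  dropping \<open>x\<close> leaves an induced path of the forbidden length.\<close>

lemma good_of_no_path:
  assumes bip: "bipartite_rel s e" and her: "hereditary P" and empty: "P {}"
    and small: "\<And>v. v \<in> W \<Longrightarrow> good s n P (nbrs s e v W)"
    and no_path: "\<And>xs. set xs \<subseteq> W \<Longrightarrow> ipath e xs \<Longrightarrow> length xs \<noteq> t"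
  shows "good s (path_bound n t) (conn_all e P) W"
proof (rule good_conn_all)
  show "symp e" "P {}" using bipartite_rel_symp[OF bip] empty .
next
  fix x assume x: "x \<in> W"
  let ?D = "component e W x"
  have t: "t > 0" using no_path[of "[]"] by (auto simp: ipath_def)
  have "\<not> (\<exists>xs. length xs = t \<and> set xs \<subseteq> ?D \<and> ipath e (x # xs))"
  proof
    assume "\<exists>xs. length xs = t \<and> set xs \<subseteq> ?D \<and> ipath e (x # xs)"
    then obtain xs where xs: "length xs = t" "set xs \<subseteq> W" "ipath e (x # xs)"
      using component_subset[of e W x] by blast
    have "ipath e xs" unfolding ipath_def
    proof (intro conjI allI impI)
      fix i j assume "i < length xs" "j < length xs"
      then have "Suc i < length (x # xs)" "Suc j < length (x # xs)" by auto
      then have "e ((x # xs) ! Suc i) ((x # xs) ! Suc j) \<longleftrightarrow> Suc i = Suc (Suc j) \<or> Suc j = Suc (Suc i)"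
        using xs(3) unfolding ipath_def by blast
      then show "e (xs ! i) (xs ! j) \<longleftrightarrow> i = Suc j \<or> j = Suc i" by simp
    qed (use xs(3) in \<open>auto simp: ipath_def\<close>)
    then show False using no_path xs by blast
  qed
  moreover have "good s n P (nbrs s e u ?D)" if "u \<in> insert x ?D" for u
  proof -
    have "u \<in> W" using that x component_subset[of e W x] by blast
    then show ?thesis using small good_subset[OF her] non_nbrs_mono[OF component_subset] by metis
  qed
  ultimately show "good s (path_bound n t) (conn_all e P) ?D"
    using path_or_good[OF bip her conn_component[OF bipartite_rel_symp[OF bip] x] component_refl[OF x], where v = x]
    by blast
qed

section \<open>Alternating chains\<close>

text \<open>An even chain begins with a left vertex whose right non-neighbours are discarded, an odd one
  with a right vertex whose left neighbours are discarded; a chain of length \<open>2 * k\<close> is a copy of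
  \<open>H\<^sub>k\<close> listed as \<open>a\<^sub>1, b\<^sub>1, a\<^sub>2, b\<^sub>2\<close> and so on.\<close>

fun chain :: "('a \<Rightarrow> bool) \<Rightarrow> ('a \<Rightarrow> 'a \<Rightarrow> bool) \<Rightarrow> nat \<Rightarrow> 'a set \<Rightarrow> bool" where
  "chain s e 0 W \<longleftrightarrow> True"
| "chain s e (Suc a) W \<longleftrightarrow> (\<exists>v\<in>W.
     if odd a then s v \<and> chain s e a (nbrs s e v W) else \<not> s v \<and> chain s e a (non_nbrs e v W))"

lemma chain_mono: "chain s e a D \<Longrightarrow> D \<subseteq> W \<Longrightarrow> chain s e a W"
proof (induction a arbitrary: D W)
  case (Suc a)
  then obtain v where v: "v \<in> D"
    "if odd a then s v \<and> chain s e a (nbrs s e v D) else \<not> s v \<and> chain s e a (non_nbrs e v D)"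
    by auto
  then have "if odd a then s v \<and> chain s e a (nbrs s e v W) else \<not> s v \<and> chain s e a (non_nbrs e v W)"
    using Suc.IH[OF _ non_nbrs_mono[OF Suc.prems(2)]] by (auto split: if_splits)
  then show ?case using v(1) Suc.prems(2) by auto
qed simp

text \<open>The first vertex \<open>v\<close> is adjacent to every right vertex kept after it, and
  the second vertex \<open>w\<close> to no left vertex kept after it. They form the pair of index 0
  in front of the half graph of the remaining chain; indices start at 0 here.\<close>

lemma chain_half_graph:
  assumes bip: "bipartite_rel s e" and "chain s e (2 * k) W"
  shows "\<exists>a b. \<forall>i<k. a i \<in> W \<and> s (a i) \<and> b i \<in> W \<and> \<not> s (b i) \<and>
    (\<forall>j<k. e (a i) (b j) \<longleftrightarrow> i \<le> j)"
  using assms(2)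
proof (induction k arbitrary: W)
  case (Suc k)
  have "chain s e (Suc (Suc (2 * k))) W" using Suc.prems by simp
  then obtain v where v: "v \<in> W" "s v" and "chain s e (Suc (2 * k)) (nbrs s e v W)"
    by (auto simp del: chain.simps simp: chain.simps(2)[of s e "Suc (2 * k)"])
  then obtain w where w: "w \<in> nbrs s e v W" "\<not> s w"
    and ch: "chain s e (2 * k) (non_nbrs e w (nbrs s e v W))"
    by auto
  obtain a b where ab: "\<forall>i<k. a i \<in> non_nbrs e w (nbrs s e v W) \<and> s (a i) \<and>
      b i \<in> non_nbrs e w (nbrs s e v W) \<and> \<not> s (b i) \<and> (\<forall>j<k. e (a i) (b j) \<longleftrightarrow> i \<le> j)"
    using Suc.IH[OF ch] by blast
  let ?a = "case_nat v a" and ?b = "case_nat w b"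
  have sym: "e x y \<Longrightarrow> e y x" for x y using bip by (auto simp: bipartite_rel_def)
  have vw: "e v w" using v w by (auto simp: non_nbrs_def cross_compl_def)
  have vb: "e v (b i)" if "i < k" for i
    using ab that v by (auto simp: non_nbrs_def cross_compl_def)
  have wa: "\<not> e (a i) w" if "i < k" for i
    using ab that sym by (auto simp: non_nbrs_def)
  have "\<forall>i<Suc k. ?a i \<in> W \<and> s (?a i) \<and> ?b i \<in> W \<and> \<not> s (?b i) \<and>
      (\<forall>j<Suc k. e (?a i) (?b j) \<longleftrightarrow> i \<le> j)"
    using v w vw vb wa ab non_nbrs_subset[of e w "nbrs s e v W"]
      non_nbrs_subset[of "cross_compl s e" v W]
    by (auto split: nat.split simp: subset_iff)
  then show ?case by blast
qed simp

section \<open>Bi-cographs of bounded height\<close>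

text \<open>A bi-cotree label has one free value, the adjacency across the sides. With value 0 the
  node is a disjoint union, with value 1 a disjoint union in the bipartite complement; the recursion
  follows these two cases level by level.\<close>

fun bico :: "('a \<Rightarrow> bool) \<Rightarrow> ('a \<Rightarrow> 'a \<Rightarrow> bool) \<Rightarrow> nat \<Rightarrow> 'a set \<Rightarrow> bool" where
  "bico s e 0 W \<longleftrightarrow> (\<exists>x. W \<subseteq> {x})"
| "bico s e (Suc h) W \<longleftrightarrow> conn_all e (bico s e h) W \<or> conn_all (cross_compl s e) (bico s e h) W"

lemma hereditary_bico: "hereditary (bico s e h)"
  by (cases h) (auto simp: hereditary_def conn_all_def)

lemma bico_Suc: "bico s e h W \<Longrightarrow> bico s e (Suc h) W"
  using conn_allI[OF hereditary_bico] by auto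

lemma bico_empty: "bico s e h {}"
  by (induction h) (auto simp: conn_all_def)

lemma bico_one_sided:
  assumes "bipartite_rel s e" "\<And>x. x \<in> W \<Longrightarrow> s x = b" shows "bico s e (Suc h) W"
proof (induction h)
  case 0
  have "\<exists>x. D \<subseteq> {x}" if D: "D \<subseteq> W" "conn e D" for D
  proof (rule ccontr)
    assume "\<nexists>x. D \<subseteq> {x}"
    then obtain x z where "x \<in> D" "z \<in> D" "z \<notin> {x}" by blast
    then obtain w where "w \<in> D" "e x w" using conn_exit[OF D(2), of "{x}" x z] by auto
    moreover have "s x = b" "s w = b" using assms(2) D(1) \<open>x \<in> D\<close> \<open>w \<in> D\<close> by blast+
    ultimately show False using assms(1) by (auto simp: bipartite_rel_def)
  qed
  then show ?case by (simp add: conn_all_def)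
qed (rule bico_Suc)

text \<open>A single split at any vertex of side \<open>b\<close> keeps height \<open>h\<close>. If
  that side is empty, the graph is edgeless and one colour with one more level suffices; the outer
  \<open>Suc\<close> provides this colour even for \<open>m = 0\<close>.\<close>

lemma good_of_split_vertices:
  assumes bip: "bipartite_rel s e"
    and split: "\<And>v. v \<in> W \<Longrightarrow> s v = b \<Longrightarrow>
      good s m (bico s e h) (nbrs s e v W) \<and> good s m (bico s e h) (non_nbrs e v W)"
  shows "good s (Suc (m * m + m + m)) (bico s e (Suc h)) W"
proof (cases "\<exists>v\<in>W. s v = b")
  case True
  then obtain v where "v \<in> W" "s v = b" by blast
  then have "good s (m * m + m + m) (bico s e h) W"
    using split by (intro good_split[OF bip hereditary_bico, where v = v]) auto
  then show ?thesis by (rule good_mono) (auto intro: bico_Suc simp del: bico.simps)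
next
  case False
  then have "bico s e (Suc h) W" by (intro bico_one_sided[OF bip, of _ "\<not> b"]) auto
  then show ?thesis by (rule good_trivial[OF _ hereditary_bico]) simp
qed

text \<open>Induction on the combined length of the two forbidden chains, each shortening costing
  one level of height. The chain for \<open>Not \<circ> s\<close> is the second kind of sequence,
  with sides exchanged. The bound is chosen before \<open>s\<close>, \<open>e\<close> and
  \<open>W\<close>, so it applies to all subgraphs at once.\<close>

lemma good_bico:
  "\<exists>n. \<forall>s e (W :: 'a set). bipartite_rel s e \<longrightarrow>
     (\<forall>xs. set xs \<subseteq> W \<longrightarrow> length xs = t \<longrightarrow> \<not> ipath e xs \<and> \<not> ipath (cross_compl s e) xs) \<longrightarrow>
     \<not> chain s e a W \<longrightarrow> \<not> chain (Not \<circ> s) e b W \<longrightarrow> good s n (bico s e (a + b)) W"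
proof (induction "a + b" arbitrary: a b)
  case 0
  then show ?case by auto
next
  case (Suc h)
  show ?case
  proof (cases "a = 0 \<or> b = 0")
    case True
    \<comment> \<open>A chain of length 0 exists in every set, so the hypotheses are
      contradictory.\<close>
    then show ?thesis by auto
  next
    case False
    then obtain a' b' where a: "a = Suc a'" and b: "b = Suc b'" by (metis not0_implies_Suc)
    let ?np = "\<lambda>s e (W :: 'a set).
      \<forall>xs. set xs \<subseteq> W \<longrightarrow> length xs = t \<longrightarrow> \<not> ipath e xs \<and> \<not> ipath (cross_compl s e) xs"
    let ?bound = "\<lambda>a b n. \<forall>s e (W :: 'a set). bipartite_rel s e \<longrightarrow> ?np s e W \<longrightarrow>
      \<not> chain s e a W \<longrightarrow> \<not> chain (Not \<circ> s) e b W \<longrightarrow> good s n (bico s e (a + b)) W"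
    have ha: "h = a' + b" and hb: "h = a + b'" using Suc.hyps(2) a b by auto
    obtain n1 where n1: "?bound a' b n1" using Suc.hyps(1)[OF ha] ..
    obtain n2 where n2: "?bound a b' n2" using Suc.hyps(1)[OF hb] ..
    \<comment> \<open>\<open>m\<close> serves both induction hypotheses, and \<open>n\<close> both
      ways to finish: the path argument and the split at one vertex.\<close>
    define m where "m = n1 + n2"
    define n where "n = path_bound m t + Suc (m * m + m + m)"
    have "good s n (bico s e (Suc h)) W"
      if bip: "bipartite_rel s e" and np: "?np s e W"
        and ca: "\<not> chain s e a W" and cb: "\<not> chain (Not \<circ> s) e b W" for s e W
    proof -
      have np': "?np s e D" if "D \<subseteq> W" for D using np subset_trans[OF _ that] by blast
      have g1: "good s m (bico s e h) D" if "D \<subseteq> W" "\<not> chain s e a' D" for D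
        proof -
        have "\<not> chain (Not \<circ> s) e b D" using cb chain_mono that(1) by blast
        then have "good s n1 (bico s e h) D" using n1 bip np' that ha by blast
        then show ?thesis by (rule good_mono) (auto simp: m_def)
      qed
      have g2: "good s m (bico s e h) D" if "D \<subseteq> W" "\<not> chain (Not \<circ> s) e b' D" for D
        proof -
        have "\<not> chain s e a D" using ca chain_mono that(1) by blast
        then have "good s n2 (bico s e h) D" using n2 bip np' that hb by blast
        then show ?thesis by (rule good_mono) (auto simp: m_def)
      qed
      \<comment> \<open>If the restricted set contained the shorter chain, putting \<open>v\<close>
        in front would give the forbidden one. So it contains none and the induction hypothesis
        colours it; the parity of \<open>a'\<close> or \<open>b'\<close> selects the type
        concerned.\<close>
      have Lplus: "good s m (bico s e h) (nbrs s e v W)" if "odd a'" "v \<in> W" "s v" for v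
        using g1[OF non_nbrs_subset] that ca a by auto
      have Rminus: "good s m (bico s e h) (non_nbrs e v W)" if "even a'" "v \<in> W" "\<not> s v" for v
        using g1[OF non_nbrs_subset] that ca a by auto
      have Rplus: "good s m (bico s e h) (nbrs s e v W)" if "odd b'" "v \<in> W" "\<not> s v" for v
        using g2[OF non_nbrs_subset] that cb b by (auto simp: cross_compl_Not)
      have Lminus: "good s m (bico s e h) (non_nbrs e v W)" if "even b'" "v \<in> W" "s v" for v
        using g2[OF non_nbrs_subset] that cb b by auto
      consider "odd a'" "odd b'" | "even a'" "even b'" | "odd a'" "even b'" | "even a'" "odd b'"
        by blast
      then show ?thesis
      proof cases
        case 1
        have "good s (path_bound m t) (conn_all e (bico s e h)) W"
          using Lplus Rplus 1 np by (intro good_of_no_path[OF bip hereditary_bico bico_empty]) auto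
        then show ?thesis by (rule good_mono) (auto simp: n_def)
      next
        case 2
        \<comment> \<open>Complementing twice gives \<open>e\<close> back, so
          \<open>non_nbrs e\<close> is the neighbourhood operator of the complement, and the path
          argument runs there.\<close>
        note c = bipartite_rel_cross_compl[OF bip]
        have "good s (path_bound m t) (conn_all (cross_compl s e) (bico s e h)) W"
          using Lminus Rminus 2 np
          by (intro good_of_no_path[OF c hereditary_bico bico_empty])
            (auto simp: cross_compl_twice[OF bip])
        then show ?thesis by (rule good_mono) (auto simp: n_def)
      next
        case 3
        then have "good s (Suc (m * m + m + m)) (bico s e (Suc h)) W"
          using Lplus Lminus by (intro good_of_split_vertices[OF bip, of _ True]) auto
        then show ?thesis by (rule good_mono) (auto simp: n_def simp del: bico.simps)
      next
        case 4
        then have "good s (Suc (m * m + m + m)) (bico s e (Suc h)) W"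
          using Rplus Rminus by (intro good_of_split_vertices[OF bip, of _ False]) auto
        then show ?thesis by (rule good_mono) (auto simp: n_def simp del: bico.simps)
      qed
    qed
    then have "?bound a b n" using Suc.hyps(2) by simp
    then show ?thesis ..
  qed
qed

section \<open>Forbidden induced subgraphs\<close>

lemma adj_sym: "adj G u v \<longleftrightarrow> adj G v u"
  by (auto simp: adj_def)

lemma bipartite_rel_adj: "bipartite_graph G \<Longrightarrow> bipartite_rel (\<lambda>u. u \<in> lside G) (adj G)"
  by (auto simp: bipartite_graph_def bipartite_rel_def adj_def)

text \<open>An embedding of \<open>H\<close> into \<open>G\<close> is what gets constructed, while
  the definition asks for a map from the induced subgraph to \<open>H\<close>: its inverse on the
  image. Since the sides of \<open>G\<close> are disjoint, they cut the image exactly into the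
  images of the sides of \<open>H\<close>.\<close>

lemma not_excludes_inducedI:
  assumes G: "bipartite_graph G" and inj: "inj_on g (verts H)"
    and sides: "g ` lside H \<subseteq> lside G \<and> g ` rside H \<subseteq> rside G \<or>
      g ` lside H \<subseteq> rside G \<and> g ` rside H \<subseteq> lside G"
    and adj: "\<And>u v. u \<in> verts H \<Longrightarrow> v \<in> verts H \<Longrightarrow> adj G (g u) (g v) \<longleftrightarrow> adj H u v"
  shows "\<not> excludes_induced G H"
proof -
  let ?W = "g ` verts H" and ?f = "the_inv_into (verts H) g"
  have f: "?f (g x) = x" if "x \<in> verts H" for x
    using the_inv_into_f_f[OF inj that] .
  have img: "?f ` (g ` S) = S" if "S \<subseteq> verts H" for S
    using f that by (force simp: image_image)
  have sub: "lside H \<subseteq> verts H" "rside H \<subseteq> verts H" by (auto simp: verts_def)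
  have W: "?W \<subseteq> verts G" using sides by (auto simp: verts_def)
  have vW: "verts (induced G ?W) = ?W" using W by (auto simp: verts_def induced_def)
  have disj: "lside G \<inter> rside G = {}" using G by (simp add: bipartite_graph_def)
  have "lside G \<inter> ?W = g ` lside H \<and> rside G \<inter> ?W = g ` rside H \<or>
      lside G \<inter> ?W = g ` rside H \<and> rside G \<inter> ?W = g ` lside H"
    using sides
  proof
    assume "g ` lside H \<subseteq> lside G \<and> g ` rside H \<subseteq> rside G"
    then show ?thesis using disj by (intro disjI1) (auto simp: verts_def)
  next
    assume "g ` lside H \<subseteq> rside G \<and> g ` rside H \<subseteq> lside G"
    then show ?thesis using disj by (intro disjI2) (auto simp: verts_def)
  qed
  then have "?f ` (lside G \<inter> ?W) = lside H \<and> ?f ` (rside G \<inter> ?W) = rside H \<or>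
      ?f ` (lside G \<inter> ?W) = rside H \<and> ?f ` (rside G \<inter> ?W) = lside H"
    using img[OF sub(1)] img[OF sub(2)] by metis
  moreover have "bij_betw ?f ?W (verts H)"
    using bij_betw_the_inv_into[OF inj_on_imp_bij_betw[OF inj]] .
  moreover have "adj (induced G ?W) u v \<longleftrightarrow> adj H (?f u) (?f v)" if "u \<in> ?W" "v \<in> ?W" for u v
  proof -
    have "adj (induced G ?W) u v \<longleftrightarrow> adj G u v" using that by (auto simp: adj_def induced_def)
    then show ?thesis using that adj f by auto
  qed
  ultimately have "bigraph_iso (induced G ?W) H"
    unfolding bigraph_iso_def vW by (intro exI[of _ ?f]) (simp add: induced_def)
  then show ?thesis using W unfolding excludes_induced_def by blast
qed

section \<open>Paths in the graph and in its bipartite complement\<close>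

lemma ipath_sides:
  assumes "bipartite_rel s e" "ipath e xs" "i < length xs"
  shows "s (xs ! i) \<longleftrightarrow> (even i \<longleftrightarrow> s (xs ! 0))"
  using assms(3)
proof (induction i)
  case (Suc i)
  then have "e (xs ! i) (xs ! Suc i)" using assms(2) by (auto simp: ipath_def)
  then have "s (xs ! i) \<noteq> s (xs ! Suc i)" using assms(1) by (auto simp: bipartite_rel_def)
  then show ?case using Suc by auto
qed simp

lemma adj_path_graph:
  "adj (path_graph t) i j \<longleftrightarrow> i < t \<and> j < t \<and> (i = Suc j \<or> j = Suc i)"
  by (auto simp: adj_def path_graph_def)

lemma adj_bicomplement_path_graph:
  "adj (bicomplement (path_graph t)) i j \<longleftrightarrow>
     i < t \<and> j < t \<and> even i \<noteq> even j \<and> \<not> (i = Suc j \<or> j = Suc i)"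
  by (auto simp: adj_def path_graph_def bicomplement_def)

text \<open>Covers both forbidden path patterns: \<open>e\<close> only supplies the order and the
  alternation of sides, while the adjacency to be matched is a separate hypothesis. The path may
  start on either side of \<open>G\<close>.\<close>

lemma path_embeds:
  assumes G: "bipartite_graph G" and rel: "bipartite_rel (\<lambda>u. u \<in> lside G) e"
    and xs: "set xs \<subseteq> verts G" "ipath e xs"
    and H: "lside H = {i. i < length xs \<and> even i}" "rside H = {i. i < length xs \<and> odd i}"
    and adj: "\<And>i j. i < length xs \<Longrightarrow> j < length xs \<Longrightarrow> adj G (xs ! i) (xs ! j) \<longleftrightarrow> adj H i j"
  shows "\<not> excludes_induced G H"
proof (rule not_excludes_inducedI[OF G])
  have v: "verts H = {..<length xs}" using H by (auto simp: verts_def)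
  show "inj_on (\<lambda>i. xs ! i) (verts H)"
    using xs(2) unfolding v by (auto simp: ipath_def inj_on_def nth_eq_iff_index_eq)
  show "adj G (xs ! i) (xs ! j) \<longleftrightarrow> adj H i j" if "i \<in> verts H" "j \<in> verts H" for i j
    using that adj unfolding v by auto
  have l: "xs ! i \<in> lside G \<longleftrightarrow> (even i \<longleftrightarrow> xs ! 0 \<in> lside G)" if "i < length xs" for i
    using ipath_sides[OF rel xs(2) that] .
  have r: "xs ! i \<in> rside G" if "i < length xs" "xs ! i \<notin> lside G" for i
  proof -
    have "xs ! i \<in> verts G" using xs(1) nth_mem[OF that(1)] by blast
    then show ?thesis using that(2) by (simp add: verts_def)
  qed
  show "(\<lambda>i. xs ! i) ` lside H \<subseteq> lside G \<and> (\<lambda>i. xs ! i) ` rside H \<subseteq> rside G \<or>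
      (\<lambda>i. xs ! i) ` lside H \<subseteq> rside G \<and> (\<lambda>i. xs ! i) ` rside H \<subseteq> lside G"
  proof (cases "xs ! 0 \<in> lside G")
    case True
    then show ?thesis unfolding H using l r by (intro disjI1) auto
  next
    case False
    then show ?thesis unfolding H using l r by (intro disjI2) auto
  qed
qed

lemma no_ipath:
  assumes G: "bipartite_graph G" and xs: "set xs \<subseteq> verts G" "length xs = t"
  shows "excludes_induced G (path_graph t) \<Longrightarrow> \<not> ipath (adj G) xs"
    and "excludes_induced G (bicomplement (path_graph t)) \<Longrightarrow>
      \<not> ipath (cross_compl (\<lambda>u. u \<in> lside G) (adj G)) xs"
proof -
  let ?s = "\<lambda>u. u \<in> lside G"
  note rel = bipartite_rel_adj[OF G]
  show "\<not> ipath (adj G) xs" if "excludes_induced G (path_graph t)"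
  proof
    assume p: "ipath (adj G) xs"
    then have "adj G (xs ! i) (xs ! j) \<longleftrightarrow> adj (path_graph t) i j"
      if "i < length xs" "j < length xs" for i j
      using that xs(2) by (simp add: adj_path_graph ipath_def)
    then have "\<not> excludes_induced G (path_graph t)"
      by (intro path_embeds[OF G rel xs(1) p]) (use xs(2) in \<open>auto simp: path_graph_def\<close>)
    then show False using that by contradiction
  qed
  show "\<not> ipath (cross_compl ?s (adj G)) xs" if "excludes_induced G (bicomplement (path_graph t))"
  proof
    assume p: "ipath (cross_compl ?s (adj G)) xs"
    note rel' = bipartite_rel_cross_compl[OF rel]
    have "adj G (xs ! i) (xs ! j) \<longleftrightarrow> adj (bicomplement (path_graph t)) i j"
      if ij: "i < length xs" "j < length xs" for i j
    proof -
      have "adj G (xs ! i) (xs ! j) \<longleftrightarrow> ?s (xs ! i) \<noteq> ?s (xs ! j) \<and>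
          \<not> cross_compl ?s (adj G) (xs ! i) (xs ! j)"
        using rel by (auto simp: cross_compl_def bipartite_rel_def)
      also have "\<dots> \<longleftrightarrow> even i \<noteq> even j \<and> \<not> (i = Suc j \<or> j = Suc i)"
        using p ij ipath_sides[OF rel' p ij(1)] ipath_sides[OF rel' p ij(2)]
        unfolding ipath_def by blast
      finally show ?thesis using ij xs(2) by (simp add: adj_bicomplement_path_graph)
    qed
    then have "\<not> excludes_induced G (bicomplement (path_graph t))"
      by (intro path_embeds[OF G rel' xs(1) p])
        (use xs(2) in \<open>auto simp: path_graph_def bicomplement_def\<close>)
    then show False using that by contradiction
  qed
qed

section \<open>Half graphs obtained from chains\<close>

lemma adj_half_graph:
  "adj (half_graph k) (Inl i) (Inr j) \<longleftrightarrow> 1 \<le> i \<and> i \<le> j \<and> j \<le> k"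
  "adj (half_graph k) (Inr j) (Inl i) \<longleftrightarrow> 1 \<le> i \<and> i \<le> j \<and> j \<le> k"
  "\<not> adj (half_graph k) (Inl i) (Inl j)" "\<not> adj (half_graph k) (Inr i) (Inr j)"
  by (auto simp: adj_def half_graph_def)

lemma chain_embeds_half_graph:
  assumes G: "bipartite_graph G" and s: "s = (\<lambda>u. u \<in> lside G) \<or> s = Not \<circ> (\<lambda>u. u \<in> lside G)"
    and "chain s (adj G) (2 * k) (verts G)"
  shows "\<not> excludes_induced G (half_graph k)"
proof -
  have rel: "bipartite_rel s (adj G)"
    using bipartite_rel_adj[OF G] s by (auto simp: bipartite_rel_def)
  obtain a b where ab: "\<And>i. i < k \<Longrightarrow> a i \<in> verts G \<and> s (a i) \<and> b i \<in> verts G \<and> \<not> s (b i)"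
    and e: "\<And>i j. i < k \<Longrightarrow> j < k \<Longrightarrow> adj G (a i) (b j) \<longleftrightarrow> i \<le> j"
    using chain_half_graph[OF rel assms(3)] by blast
  have nadj: "\<not> adj G u v" if "s u = s v" for u v
    using rel that by (auto simp: bipartite_rel_def)
  \<comment> \<open>Vertices of a half graph are told apart by their neighbourhoods:
    \<open>a j\<close> is adjacent to \<open>b j\<close>, so \<open>a i = a j\<close> forces
    \<open>i \<le> j\<close>, and symmetrically.\<close>
  have inj_a: "i = j" if "i < k" "j < k" "a i = a j" for i j
  proof (rule antisym)
    show "i \<le> j" using e[OF that(1,2)] e[OF that(2,2)] that(3) by simp
    show "j \<le> i" using e[OF that(2,1)] e[OF that(1,1)] that(3) by simp
  qed
  have inj_b: "i = j" if "i < k" "j < k" "b i = b j" for i j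
  proof (rule antisym)
    show "i \<le> j" using e[OF that(1,2)] e[OF that(1,1)] that(3) by simp
    show "j \<le> i" using e[OF that(2,1)] e[OF that(2,2)] that(3) by simp
  qed
  have neq: "a i \<noteq> b j" if "i < k" "j < k" for i j
  proof
    assume "a i = b j"
    then show False using ab[OF that(1)] ab[OF that(2)] by simp
  qed
  \<comment> \<open>The shift by one passes from indices starting at 0 to those of
    \<open>half_graph\<close>, which start at 1.\<close>
  define g where "g = case_sum (\<lambda>i. a (i - 1)) (\<lambda>i. b (i - 1))"
  have g: "g (Inl (Suc i)) = a i" "g (Inr (Suc i)) = b i" for i by (simp_all add: g_def)
  have v: "(\<exists>i<k. x = Inl (Suc i)) \<or> (\<exists>i<k. x = Inr (Suc i))" if x: "x \<in> verts (half_graph k)" for x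
  proof -
    obtain i where "x = Inl i \<or> x = Inr i" "1 \<le> i" "i \<le> k"
      using x by (auto simp: verts_def half_graph_def)
    then show ?thesis by (cases i) auto
  qed
  show ?thesis
  proof (rule not_excludes_inducedI[OF G, of g])
    show "inj_on g (verts (half_graph k))"
    proof (rule inj_onI)
      fix x y assume xy: "x \<in> verts (half_graph k)" "y \<in> verts (half_graph k)" "g x = g y"
      then show "x = y" using v[OF xy(1)] v[OF xy(2)]
        by (elim disjE exE conjE) (auto simp: g neq neq[symmetric] dest: inj_a inj_b)
    qed
    show "adj G (g x) (g y) \<longleftrightarrow> adj (half_graph k) x y"
      if xy: "x \<in> verts (half_graph k)" "y \<in> verts (half_graph k)" for x y
      using v[OF xy(1)] v[OF xy(2)]
    proof (elim disjE exE conjE)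
      fix i j assume "i < k" "j < k" "x = Inl (Suc i)" "y = Inl (Suc j)"
      then show ?thesis using ab nadj[of "a i" "a j"] by (simp add: g adj_half_graph)
    next
      fix i j assume "i < k" "j < k" "x = Inr (Suc i)" "y = Inr (Suc j)"
      then show ?thesis using ab nadj[of "b i" "b j"] by (simp add: g adj_half_graph)
    next
      fix i j assume "i < k" "j < k" "x = Inl (Suc i)" "y = Inr (Suc j)"
      then show ?thesis using e by (auto simp: g adj_half_graph)
    next
      fix i j assume "i < k" "j < k" "x = Inr (Suc i)" "y = Inl (Suc j)"
      then show ?thesis using e[of j i] adj_sym[of G "b i" "a j"] by (auto simp: g adj_half_graph)
    qed
    have A: "g ` lside (half_graph k) \<subseteq> {u \<in> verts G. s u}"
      using ab by (auto simp: half_graph_def g_def)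
    have B: "g ` rside (half_graph k) \<subseteq> {u \<in> verts G. \<not> s u}"
      using ab by (auto simp: half_graph_def g_def)
    show "g ` lside (half_graph k) \<subseteq> lside G \<and> g ` rside (half_graph k) \<subseteq> rside G \<or>
        g ` lside (half_graph k) \<subseteq> rside G \<and> g ` rside (half_graph k) \<subseteq> lside G"
      using s
    proof
      assume "s = (\<lambda>u. u \<in> lside G)"
      then show ?thesis using A B by (intro disjI1) (auto simp: verts_def)
    next
      assume "s = Not \<circ> (\<lambda>u. u \<in> lside G)"
      then show ?thesis using A B by (intro disjI2) (auto simp: verts_def)
    qed
  qed
qed

section \<open>Building cotrees\<close>

lemma find_lca:
  assumes "distinct (concat (map leaves ts))" "r \<in> set ts" "u \<in> set (leaves r)" "v \<in> set (leaves r)"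
  shows "find (\<lambda>r. u \<in> set (leaves r) \<and> v \<in> set (leaves r)) ts = Some r"
  using assms by (induction ts) auto

lemma distinct_concat_pieces:
  assumes "distinct qs" "disjoint (set qs)" "\<And>X. X \<in> set qs \<Longrightarrow> X \<noteq> {} \<and> tree_on X (T X)"
  shows "distinct (concat (map leaves (map T qs)))"
  using assms
proof (induction qs)
  case (Cons X qs)
  have "X \<inter> Y = {}" if "Y \<in> set qs" for Y
    using Cons.prems(1,2) that by (auto simp: disjoint_def)
  moreover have "disjoint (set qs)" using Cons.prems(2) by (auto simp: disjoint_def)
  ultimately show ?case using Cons by (fastforce simp: tree_on_def)
qed simp

text \<open>The given trees are hung below a new root labelled \<open>l\<close>, in any order. Two
  vertices of one piece still meet inside its tree, and vertices of different pieces meet at the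
  root.\<close>

lemma tree_of_pieces:
  fixes T :: "'a set \<Rightarrow> ('l, 'a) rtree"
  assumes fin: "finite Q" and ne: "Q \<noteq> {}" and dis: "disjoint Q"
    and T: "\<And>X. X \<in> Q \<Longrightarrow> X \<noteq> {} \<and> tree_on X (T X) \<and> height (T X) \<le> h"
  shows "\<exists>R. tree_on (\<Union>Q) R \<and> height R \<le> Suc h \<and> labels R \<subseteq> insert l (\<Union>X\<in>Q. labels (T X)) \<and>
    (\<forall>X\<in>Q. \<forall>u\<in>X. \<forall>v\<in>X. lca R u v = lca (T X) u v) \<and>
    (\<forall>X\<in>Q. \<forall>Y\<in>Q. X \<noteq> Y \<longrightarrow> (\<forall>u\<in>X. \<forall>v\<in>Y. root_label (lca R u v) = l))"
proof -
  obtain qs where qs: "set qs = Q" "distinct qs" using finite_distinct_list[OF fin] by blast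
  let ?ts = "map T qs"
  let ?R = "Node l ?ts"
  have lv: "set (leaves (T X)) = X" if "X \<in> Q" for X using T[OF that] by (simp add: tree_on_def)
  have d: "distinct (concat (map leaves ?ts))"
    using T dis by (intro distinct_concat_pieces) (auto simp: qs)
  have "tree_on (\<Union>Q) ?R"
    using d ne T lv qs by (auto simp: tree_on_def)
  moreover have "height ?R \<le> Suc h"
    using T fin ne qs by auto
  moreover have "labels ?R \<subseteq> insert l (\<Union>X\<in>Q. labels (T X))" using qs by auto
  moreover have "lca ?R u v = lca (T X) u v" if "X \<in> Q" "u \<in> X" "v \<in> X" for X u v
    using find_lca[OF d, of "T X" u v] that lv[OF that(1)] qs by simp
  moreover have "root_label (lca ?R u v) = l"
    if XY: "X \<in> Q" "Y \<in> Q" "X \<noteq> Y" "u \<in> X" "v \<in> Y" for X Y u v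
  proof -
    have "find (\<lambda>r. u \<in> set (leaves r) \<and> v \<in> set (leaves r)) ?ts = None"
      unfolding find_None_iff
    proof
      assume "\<exists>r. r \<in> set ?ts \<and> u \<in> set (leaves r) \<and> v \<in> set (leaves r)"
      then obtain Z where "Z \<in> Q" "u \<in> Z" "v \<in> Z" using lv qs by auto
      then have "Z = X" "Z = Y" using dis XY by (auto simp: disjoint_def)
      then show False using XY by blast
    qed
    then show ?thesis by simp
  qed
  ultimately show ?thesis by blast
qed

lemma star_tree:
  assumes "finite V" "V \<noteq> {}"
  shows "\<exists>R :: ('l, 'a) rtree. tree_on V R \<and> height R \<le> Suc 0 \<and> labels R \<subseteq> {l} \<and>
    (\<forall>u\<in>V. \<forall>v\<in>V. u \<noteq> v \<longrightarrow> root_label (lca R u v) = l)"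
proof -
  let ?Q = "(\<lambda>x. {x}) ` V"
  have "\<exists>R :: ('l, 'a) rtree. tree_on (\<Union>?Q) R \<and> height R \<le> Suc 0 \<and>
    labels R \<subseteq> insert l (\<Union>X\<in>?Q. labels (Leaf (the_elem X) :: ('l, 'a) rtree)) \<and>
    (\<forall>X\<in>?Q. \<forall>u\<in>X. \<forall>v\<in>X. lca R u v = lca (Leaf (the_elem X)) u v) \<and>
    (\<forall>X\<in>?Q. \<forall>Y\<in>?Q. X \<noteq> Y \<longrightarrow> (\<forall>u\<in>X. \<forall>v\<in>Y. root_label (lca R u v) = l))"
    by (rule tree_of_pieces) (use assms in \<open>auto simp: disjoint_def tree_on_def\<close>)
  then obtain R :: "('l, 'a) rtree" where R: "tree_on (\<Union>?Q) R" "height R \<le> Suc 0"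
      "labels R \<subseteq> insert l (\<Union>X\<in>?Q. labels (Leaf (the_elem X) :: ('l, 'a) rtree))"
    and diff: "\<forall>X\<in>?Q. \<forall>Y\<in>?Q. X \<noteq> Y \<longrightarrow> (\<forall>u\<in>X. \<forall>v\<in>Y. root_label (lca R u v) = l)"
    by (elim exE conjE)
  have "root_label (lca R u v) = l" if "u \<in> V" "v \<in> V" "u \<noteq> v" for u v
    using diff that by simp
  moreover have "labels R \<subseteq> {l}" using R(3) by simp
  moreover have "tree_on V R" using R(1) by simp
  ultimately show ?thesis using R(2) by (intro exI[of _ R]) simp
qed

text \<open>The children of the root are the trees of the components. The separate side function
  \<open>sd\<close> only has to agree with \<open>s\<close> up to exchange of the sides, since
  \<open>between G A B\<close> calls \<open>A\<close> left even when \<open>A\<close> lies on the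
  right of \<open>G\<close>.\<close>

lemma bico_tree:
  assumes bip: "bipartite_rel s e" and "bico s e h X" "finite X" "X \<noteq> {}"
    and "\<And>u v. u \<in> X \<Longrightarrow> v \<in> X \<Longrightarrow> sd u = sd v \<longleftrightarrow> s u = s v"
  shows "\<exists>T :: (side \<Rightarrow> side \<Rightarrow> bool, 'a) rtree. tree_on X T \<and> height T \<le> h \<and>
    (\<forall>f\<in>labels T. bicotree_label f) \<and>
    (\<forall>u\<in>X. \<forall>v\<in>X. u \<noteq> v \<longrightarrow> (e u v \<longleftrightarrow> root_label (lca T u v) (sd u) (sd v)))"
  using assms(2-)
proof (induction h arbitrary: X)
  case 0
  then obtain x where "X = {x}" by auto
  then show ?case by (intro exI[of _ "Leaf x"]) (auto simp: tree_on_def)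
next
  case (Suc h)
  \<comment> \<open>\<open>r\<close> is the relation whose components become the children, and
    \<open>b\<close> the adjacency between opposite sides of different components:
    \<open>False\<close> for \<open>e\<close>, \<open>True\<close> for its complement.\<close>
  obtain r b where r: "conn_all r (bico s e h) X" "symp r"
    and rb: "\<And>u v. \<not> r u v \<Longrightarrow> e u v \<longleftrightarrow> s u \<noteq> s v \<and> b"
  proof -
    from Suc.prems(1) consider "conn_all e (bico s e h) X"
      | "conn_all (cross_compl s e) (bico s e h) X" by auto
    then show ?thesis
    proof cases
      case 1
      then show ?thesis using that[of e False] bipartite_rel_symp[OF bip] by auto
    next
      case 2
      then show ?thesis
        using that[of "cross_compl s e" True] bip
          bipartite_rel_symp[OF bipartite_rel_cross_compl[OF bip]]
        by (auto simp: cross_compl_def bipartite_rel_def)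
    qed
  qed
  let ?Q = "component r X ` X"
  have sub: "Y \<subseteq> X \<and> Y \<noteq> {} \<and> finite Y" if "Y \<in> ?Q" for Y
    using that component_subset[of r X] component_refl[of _ X r] finite_subset[OF _ Suc.prems(2)]
    by blast
  have "\<exists>T :: (side \<Rightarrow> side \<Rightarrow> bool, 'a) rtree. tree_on Y T \<and> height T \<le> h \<and>
      (\<forall>f\<in>labels T. bicotree_label f) \<and>
      (\<forall>u\<in>Y. \<forall>v\<in>Y. u \<noteq> v \<longrightarrow> (e u v \<longleftrightarrow> root_label (lca T u v) (sd u) (sd v)))"
    if "Y \<in> ?Q" for Y
  proof (rule Suc.IH)
    have "conn r Y" using that conn_component[OF r(2)] by blast
    then show "bico s e h Y" using r(1) sub[OF that] unfolding conn_all_def by blast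
    show "sd u = sd v \<longleftrightarrow> s u = s v" if "u \<in> Y" "v \<in> Y" for u v
      using Suc.prems(4) that sub[OF \<open>Y \<in> ?Q\<close>] by blast
  qed (use sub[OF that] in blast)+
  then have "\<forall>Y\<in>?Q. \<exists>T :: (side \<Rightarrow> side \<Rightarrow> bool, 'a) rtree. tree_on Y T \<and> height T \<le> h \<and>
      (\<forall>f\<in>labels T. bicotree_label f) \<and>
      (\<forall>u\<in>Y. \<forall>v\<in>Y. u \<noteq> v \<longrightarrow> (e u v \<longleftrightarrow> root_label (lca T u v) (sd u) (sd v)))"
    by blast
  from bchoice[OF this] obtain T :: "'a set \<Rightarrow> (side \<Rightarrow> side \<Rightarrow> bool, 'a) rtree"
    where T: "\<forall>Y\<in>?Q. tree_on Y (T Y) \<and> height (T Y) \<le> h \<and>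
      (\<forall>f\<in>labels (T Y). bicotree_label f) \<and>
      (\<forall>u\<in>Y. \<forall>v\<in>Y. u \<noteq> v \<longrightarrow> (e u v \<longleftrightarrow> root_label (lca (T Y) u v) (sd u) (sd v)))" ..
  let ?l = "\<lambda>i j :: side. i \<noteq> j \<and> b"
  have dis: "disjoint ?Q"
  proof (rule disjointI)
    fix Y Z assume YZ: "Y \<in> ?Q" "Z \<in> ?Q" "Y \<noteq> Z"
    then obtain y z where yz: "Y = component r X y" "Z = component r X z" by blast
    show "Y \<inter> Z = {}"
    proof (rule ccontr)
      assume "Y \<inter> Z \<noteq> {}"
      then obtain x where "x \<in> component r X y" "x \<in> component r X z" using yz by blast
      then have "component r X x = Y" "component r X x = Z"
        using component_eq[OF r(2)] yz by blast+
      then show False using YZ(3) by simp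
    qed
  qed
  have "\<exists>R. tree_on (\<Union>?Q) R \<and> height R \<le> Suc h \<and> labels R \<subseteq> insert ?l (\<Union>Y\<in>?Q. labels (T Y)) \<and>
    (\<forall>Y\<in>?Q. \<forall>u\<in>Y. \<forall>v\<in>Y. lca R u v = lca (T Y) u v) \<and>
    (\<forall>Y\<in>?Q. \<forall>Z\<in>?Q. Y \<noteq> Z \<longrightarrow> (\<forall>u\<in>Y. \<forall>v\<in>Z. root_label (lca R u v) = ?l))"
    using Suc.prems(2,3) dis T sub by (intro tree_of_pieces) blast+
  then obtain R where R: "tree_on (\<Union>?Q) R" "height R \<le> Suc h"
      "labels R \<subseteq> insert ?l (\<Union>Y\<in>?Q. labels (T Y))"
    and same: "\<forall>Y\<in>?Q. \<forall>u\<in>Y. \<forall>v\<in>Y. lca R u v = lca (T Y) u v"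
    and diff: "\<forall>Y\<in>?Q. \<forall>Z\<in>?Q. Y \<noteq> Z \<longrightarrow> (\<forall>u\<in>Y. \<forall>v\<in>Z. root_label (lca R u v) = ?l)"
    by (elim exE conjE)
  have "\<Union>?Q = X" using sub component_refl[of _ X r] by blast
  moreover have "bicotree_label f" if "f \<in> labels R" for f
  proof -
    have "f = ?l \<or> (\<exists>Y\<in>?Q. f \<in> labels (T Y))" using R(3) that by blast
    then show ?thesis
    proof
      assume "f = ?l"
      then show ?thesis by (auto simp: bicotree_label_def)
    qed (use T in blast)
  qed
  moreover have "e u v \<longleftrightarrow> root_label (lca R u v) (sd u) (sd v)"
    if uv: "u \<in> X" "v \<in> X" "u \<noteq> v" for u v
  proof (cases "v \<in> component r X u")
    case True
    then show ?thesis
      using same T uv component_refl[of u X r] by fastforce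
  next
    case False
    then have "\<not> r u v" using component_closed[OF component_refl] uv by metis
    then have "e u v \<longleftrightarrow> s u \<noteq> s v \<and> b" by (rule rb)
    moreover have "component r X u \<noteq> component r X v"
      using False component_refl[OF uv(2), of r] by blast
    then have "root_label (lca R u v) = ?l"
      using diff uv component_refl[of _ X r] by blast
    ultimately show ?thesis using Suc.prems(4)[OF uv(1,2)] by auto
  qed
  ultimately show ?case using R(1,2) by (intro exI[of _ R]) auto
qed

section \<open>Parts and pairs of parts of a 2-cosplit\<close>

lemma cograph_height_le_edgeless:
  assumes "finite V" "V \<noteq> {}" "\<And>u v. u \<in> V \<Longrightarrow> v \<in> V \<Longrightarrow> \<not> E u v" "h \<ge> 1"
  shows "cograph_height_le h V E"
proof -
  obtain R where "tree_on V R \<and> height R \<le> Suc 0 \<and> labels R \<subseteq> {False} \<and>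
    (\<forall>u\<in>V. \<forall>v\<in>V. u \<noteq> v \<longrightarrow> root_label (lca R u v) = False)"
    using star_tree[OF assms(1,2)] ..
  then show ?thesis unfolding cograph_height_le_def
    using assms(3,4) by (intro exI[of _ R]) auto
qed

lemma bicograph_height_le_edgeless:
  assumes "finite (verts G)" "verts G \<noteq> {}"
    "\<And>u v. u \<in> verts G \<Longrightarrow> v \<in> verts G \<Longrightarrow> \<not> adj G u v" "h \<ge> 1"
  shows "bicograph_height_le h G"
proof -
  let ?l = "(\<lambda>_ _. False) :: side \<Rightarrow> side \<Rightarrow> bool"
  obtain R where "tree_on (verts G) R \<and> height R \<le> Suc 0 \<and> labels R \<subseteq> {?l} \<and>
    (\<forall>u\<in>verts G. \<forall>v\<in>verts G. u \<noteq> v \<longrightarrow> root_label (lca R u v) = ?l)"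
    using star_tree[OF assms(1,2)] ..
  then show ?thesis unfolding bicograph_height_le_def
    using assms(3,4) by (intro exI[of _ R]) (auto simp: bicotree_label_def)
qed

lemma verts_between: "verts (between G A B) = A \<union> B"
  by (simp add: verts_def between_def)

lemma adj_between:
  "adj (between G A B) u v \<longleftrightarrow> adj G u v \<and> (u \<in> A \<and> v \<in> B \<or> u \<in> B \<and> v \<in> A)"
  unfolding between_def adj_def by auto

lemma bicograph_height_le_between:
  assumes G: "bipartite_graph G" and "A \<inter> B = {}" "A \<union> B \<subseteq> verts G" "A \<noteq> {}"
    and sides: "A \<subseteq> lside G \<and> B \<subseteq> rside G \<or> A \<subseteq> rside G \<and> B \<subseteq> lside G"
    and bico: "bico (\<lambda>u. u \<in> lside G) (adj G) h (A \<union> B)"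
  shows "bicograph_height_le h (between G A B)"
proof -
  let ?G = "between G A B"
  have disj: "lside G \<inter> rside G = {}" and fin: "finite (verts G)"
    using G by (auto simp: bipartite_graph_def verts_def)
  note v = verts_between[of G A B]
  have adj: "adj ?G u v \<longleftrightarrow> adj G u v" if "u \<in> A \<union> B" "v \<in> A \<union> B" for u v
  proof -
    have "adj G u v \<Longrightarrow> (u \<in> lside G) \<noteq> (v \<in> lside G)"
      using bipartite_rel_adj[OF G] by (simp add: bipartite_rel_def)
    then show ?thesis using that sides disj by (auto simp: adj_between)
  qed
  have sd: "side_of ?G u = side_of ?G v \<longleftrightarrow> (u \<in> lside G) = (v \<in> lside G)"
    if "u \<in> A \<union> B" "v \<in> A \<union> B" for u v
    using that sides disj assms(2) by (auto simp: side_of_def between_def)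
  show ?thesis
    unfolding bicograph_height_le_def v
    using bico_tree[OF bipartite_rel_adj[OF G] bico finite_subset[OF assms(3) fin] _ sd] assms(4)
    by (simp add: adj)
qed

text \<open>The parts are the nonempty colour classes, at most \<open>n\<close> on each side. One
  part, or two on the same side, carry no edges, so a star of height 1 suffices; pairs from opposite
  sides are exactly what \<open>good\<close> controls.\<close>

lemma two_cosplit_of_good:
  assumes G: "bipartite_graph G" and h: "h \<ge> 1"
    and good: "good (\<lambda>u. u \<in> lside G) n (bico (\<lambda>u. u \<in> lside G) (adj G) h) (verts G)"
  shows "\<exists>P. two_cosplit G P \<and> card P \<le> 2 * n \<and> cosplit_height_le h G P"
proof (rule goodE[OF good])
  let ?s = "\<lambda>u. u \<in> lside G"
  fix c :: "'a \<Rightarrow> nat"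
  assume c: "\<And>x. x \<in> verts G \<Longrightarrow> c x < n"
    and cls: "\<And>i j. bico ?s (adj G) h {x \<in> verts G. c x = (if ?s x then i else j)}"
  define C where "C = (\<lambda>(b, i). {x \<in> verts G. ?s x = b \<and> c x = i})"
  define P where "P = C ` (UNIV \<times> {..<n}) - {{}}"
  have fin: "finite (verts G)" using G by (simp add: bipartite_graph_def verts_def)
  have nadj: "\<not> adj G u v" if "?s u = ?s v" for u v
    using bipartite_rel_adj[OF G] that by (auto simp: bipartite_rel_def)
  have P: "\<exists>b i. A = C (b, i) \<and> A \<noteq> {}" if "A \<in> P" for A
    using that by (auto simp: P_def)
  have C_side: "?s u = b \<and> u \<in> verts G" if "u \<in> C (b, i)" for u b i
    using that by (auto simp: C_def)
  have finA: "finite A" if "A \<in> P" for A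
    using P[OF that] fin by (auto simp: C_def)
  have card: "card P \<le> 2 * n"
  proof -
    have "card P \<le> card (C ` (UNIV \<times> {..<n}))" unfolding P_def by (intro card_mono) auto
    also have "\<dots> \<le> card ((UNIV :: bool set) \<times> {..<n})" by (intro card_image_le) auto
    finally show ?thesis by (simp add: card_cartesian_product)
  qed
  have part: "partition_on (verts G) P"
  proof (rule partition_onI)
    show "\<Union>P = verts G"
    proof
      show "\<Union>P \<subseteq> verts G" by (auto simp: P_def C_def)
      show "verts G \<subseteq> \<Union>P"
      proof
        fix x assume x: "x \<in> verts G"
        then have "x \<in> C (?s x, c x)" "(?s x, c x) \<in> UNIV \<times> {..<n}" using c by (auto simp: C_def)
        then show "x \<in> \<Union>P" unfolding P_def by blast
      qed
    qed
    show "disjnt A B" if "A \<in> P" "B \<in> P" "A \<noteq> B" for A B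
      using that by (auto simp: P_def C_def disjnt_def)
    show "{} \<notin> P" by (simp add: P_def)
  qed
  have sides: "A \<subseteq> lside G \<or> A \<subseteq> rside G" if "A \<in> P" for A
    using P[OF that] by (auto simp: C_def verts_def)
  have cog: "cograph_height_le h A (adj G)" if "A \<in> P" for A
  proof -
    have "\<not> adj G u v" if "u \<in> A" "v \<in> A" for u v
      using P[OF \<open>A \<in> P\<close>] C_side that nadj by metis
    then show ?thesis using P[OF that] finA[OF that] h by (intro cograph_height_le_edgeless) auto
  qed
  have bicog: "bicograph_height_le h (between G A B)" if AB: "A \<in> P" "B \<in> P" "A \<noteq> B" for A B
  proof -
    obtain b i where A: "A = C (b, i)" "A \<noteq> {}" using P[OF AB(1)] by blast
    obtain b' j where B: "B = C (b', j)" "B \<noteq> {}" using P[OF AB(2)] by blast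
    show ?thesis
    proof (cases "b = b'")
      case True
      show ?thesis
      proof (rule bicograph_height_le_edgeless)
        note v = verts_between[of G A B]
        show "finite (verts (between G A B))" "verts (between G A B) \<noteq> {}"
          unfolding v using finA AB A(2) by auto
        have "?s u = b" if "u \<in> A \<union> B" for u using that A B True C_side by blast
        then show "\<not> adj (between G A B) u v"
          if "u \<in> verts (between G A B)" "v \<in> verts (between G A B)" for u v
          using nadj that unfolding v by (simp add: adj_between)
      qed (rule h)
    next
      case False
      show ?thesis
      proof (rule bicograph_height_le_between[OF G])
        show "A \<inter> B = {}" "A \<union> B \<subseteq> verts G" "A \<noteq> {}"
          using A B False by (auto simp: C_def)
        show "A \<subseteq> lside G \<and> B \<subseteq> rside G \<or> A \<subseteq> rside G \<and> B \<subseteq> lside G"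
          using A B False by (cases b) (auto simp: C_def verts_def)
        have "A \<union> B = {x \<in> verts G. c x = (if ?s x then (if b then i else j) else (if b then j else i))}"
          using A(1) B(1) False by (cases b) (auto simp: C_def)
        then show "bico ?s (adj G) h (A \<union> B)" using cls by simp
      qed
    qed
  qed
  have "two_cosplit G P" unfolding two_cosplit_def cograph_def bicograph_def
    using part sides cog bicog by blast
  moreover have "cosplit_height_le h G P" unfolding cosplit_height_le_def
    using cog bicog by blast
  ultimately show ?thesis using card by blast
qed

theorem theorem5p1:
  fixes t k :: nat
  shows "\<exists>N::nat. \<forall>G::'a bigraph.
           bipartite_graph G \<longrightarrow>
           excludes_induced G (path_graph t) \<longrightarrow>
           excludes_induced G (bicomplement (path_graph t)) \<longrightarrow>
           excludes_induced G (half_graph k) \<longrightarrow>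
           (\<exists>P. two_cosplit G P \<and> card P \<le> N \<and> cosplit_height_le (4 * k) G P)"
proof -
  obtain n where n: "\<forall>s e (W :: 'a set). bipartite_rel s e \<longrightarrow>
     (\<forall>xs. set xs \<subseteq> W \<longrightarrow> length xs = t \<longrightarrow> \<not> ipath e xs \<and> \<not> ipath (cross_compl s e) xs) \<longrightarrow>
     \<not> chain s e (2 * k) W \<longrightarrow> \<not> chain (Not \<circ> s) e (2 * k) W \<longrightarrow>
     good s n (bico s e (2 * k + 2 * k)) W"
    using good_bico ..
  have "\<exists>P. two_cosplit G P \<and> card P \<le> 2 * n \<and> cosplit_height_le (4 * k) G P"
    if G: "bipartite_graph G" and 1: "excludes_induced G (path_graph t)"
      and 2: "excludes_induced G (bicomplement (path_graph t))"
      and 3: "excludes_induced G (half_graph k)" for G :: "'a bigraph"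
  proof -
    let ?s = "\<lambda>u. u \<in> lside G"
    have nc: "\<not> chain ?s (adj G) (2 * k) (verts G)" "\<not> chain (Not \<circ> ?s) (adj G) (2 * k) (verts G)"
      using chain_embeds_half_graph[OF G, of ?s k] chain_embeds_half_graph[OF G, of "Not \<circ> ?s" k] 3
      by auto
    \<comment> \<open>The empty chain always exists, so excluding chains of length
      \<open>2 * k\<close> makes \<open>k\<close> positive. This yields the height of at least 1
      that edgeless pieces take.\<close>
    have "k \<noteq> 0"
    proof
      assume "k = 0"
      then show False using nc(1) by simp
    qed
    have "good ?s n (bico ?s (adj G) (2 * k + 2 * k)) (verts G)"
      using n[rule_format, OF bipartite_rel_adj[OF G] _ nc] no_ipath[OF G] 1 2 by simp
    moreover have "2 * k + 2 * k = 4 * k" by simp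
    ultimately show ?thesis using \<open>k \<noteq> 0\<close> by (intro two_cosplit_of_good[OF G]) simp_all
  qed
  then show ?thesis by blast
qed

end
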